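(* For the autonomous metrical multi-time Lagrange space of electrodynamics $EDML^n_p=(J^1(T,M),L)$ with $L=h^{\alpha\beta}(t)g_{ij}(x)x^i_\alpha x^j_\beta+U^{(\alpha)}_{(i)}(t,x)x^i_\alpha+F(t,x)$, the local electromagnetic components $F^{(\alpha)}_{(i)j}$ satisfy the following equations of Maxwell type: $$\left\{\begin{array}{l} \displaystyle F^{(\alpha)}_{(i)j/\beta}=\frac12\,\mathcal A_{\{i,j\}}\,h^{\alpha\mu}g_{im}R^{(m)}_{(\mu)\beta j},\\[2mm] \displaystyle \sum_{\{i,j,k\}}F^{(\alpha)}_{(i)j\vert k}=0,\\[2mm] \displaystyle \sum_{\{i,j,k\}}F^{(\alpha)}_{(i)j}\vert^{(\gamma)}_{(k)}=0, \end{array}\right.$$ where $\mathcal A_{\{i,j\}}$ denotes an alternate sum and $\sum_{\{i,j,k\}}$ a cyclic sum.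
   Context: Setting. $T$ is a smooth real $p$-dimensional manifold with coordinates $t=(t^\alpha)$, $M$ a smooth real $n$-dimensional manifold with coordinates $x=(x^i)$; $J^1(T,M)$ is the 1-jet bundle with induced coordinates $(t^\alpha,x^i,x^i_\alpha)$. Repeated indices are summed. $h_{\alpha\beta}(t)$ and $g_{ij}(x)$ are semi-Riemannian metrics on $T$ and $M$ with inverses $h^{\alpha\beta}$, $g^{ij}$; $U^{(\alpha)}_{(i)}(t,x)$ are the components of a distinguished tensor (d-tensor) on $J^1(T,M)$, i.e. $U^{(\alpha)}_{(i)}=\frac{\partial t^\alpha}{\partial\tilde t^\beta}\frac{\partial\tilde x^j}{\partial x^i}\tilde U^{(\beta)}_{(j)}$ under changes of coordinates; $F(t,x)$ is a smooth function on $T\times M$. Put $U^{(\alpha)}_{(i)j}=\frac{\partial U^{(\alpha)}_{(i)}}{\partial x^j}-\frac{\partial U^{(\alpha)}_{(j)}}{\partial x^i}$. $H^\gamma_{\alpha\beta}$ and $\gamma^i_{jk}$ are the Christoffel symbols of $h$ and $g$. Canonical nonlinear connection. $\Gamma=(M^{(i)}_{(\alpha)\beta},N^{(i)}_{(\alpha)j})$ with $M^{(i)}_{(\alpha)\beta}=-H^\gamma_{\alpha\beta}x^i_\gamma$ and $N^{(i)}_{(\alpha)j}=\gamma^i_{jk}x^k_\alpha+\frac{h_{\alpha\gamma}g^{il}}{4}U^{(\gamma)}_{(l)j}$. Adapted frame: $\frac{\delta}{\delta t^\alpha}=\frac{\partial}{\partial t^\alpha}-M^{(j)}_{(\beta)\alpha}\frac{\partial}{\partial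 x^j_\beta}$, $\frac{\delta}{\delta x^i}=\frac{\partial}{\partial x^i}-N^{(j)}_{(\beta)i}\frac{\partial}{\partial x^j_\beta}$, $\frac{\partial}{\partial x^i_\alpha}$. Covariant derivatives. They are those induced by the Cartan canonical connection $C\Gamma=(H^\gamma_{\alpha\beta},\,G^k_{j\gamma}=0,\,L^i_{jk}=\gamma^i_{jk},\,C^{i(\gamma)}_{j(k)}=0)$. Thus $x^i_{\alpha\vert j}=\frac{\delta x^i_\alpha}{\delta x^j}+x^k_\alpha\gamma^i_{kj}$, and for a d-tensor $F^{(\alpha)}_{(i)j}$: $F^{(\alpha)}_{(i)j/\beta}=\frac{\delta F^{(\alpha)}_{(i)j}}{\delta t^\beta}+F^{(\mu)}_{(i)j}H^\alpha_{\mu\beta}$, $F^{(\alpha)}_{(i)j\vert k}=\frac{\delta F^{(\alpha)}_{(i)j}}{\delta x^k}-F^{(\alpha)}_{(m)j}\gamma^m_{ik}-F^{(\alpha)}_{(i)m}\gamma^m_{jk}$, $F^{(\alpha)}_{(i)j}\vert^{(\gamma)}_{(k)}=\frac{\partial F^{(\alpha)}_{(i)j}}{\partial x^k_\gamma}$. Electromagnetic d-tensor. $F^{(\alpha)}_{(i)j}=\frac12\left[D^{(\alpha)}_{(i)j}-D^{(\alpha)}_{(j)i}\right]$, where $D^{(\alpha)}_{(i)j}=h^{\alpha\mu}g_{im}\,x^m_{\mu\vert j}$. Torsion component. $R^{(m)}_{(\mu)\alpha j}=\frac{\delta M^{(m)}_{(\mu)\alpha}}{\delta x^j}-\frac{\delta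 N^{(m)}_{(\mu)j}}{\delta t^\alpha}=-\frac{h_{\mu\eta}g^{mk}}{4}\left[H^\eta_{\alpha\gamma}U^{(\gamma)}_{(k)j}+\frac{\partial U^{(\eta)}_{(k)j}}{\partial t^\alpha}\right]$. Sums. $\mathcal A_{\{i,j\}}S_{ij}=S_{ij}-S_{ji}$; $\sum_{\{i,j,k\}}S_{ijk}=S_{ijk}+S_{jki}+S_{kij}$. *)

theory Defs
  imports "HOL-Analysis.Analysis"
begin

section \<open>Smooth maps between open subsets of normed spaces\<close>

text \<open>Only used for open \<open>S\<close> in finite-dimensional spaces, where \<open>C_k_on k S f\<close> says that \<open>f\<close> is
  \<open>k\<close> times continuously differentiable on \<open>S\<close>.\<close>

primrec C_k_on ::
  "nat \<Rightarrow> 'a::real_normed_vector set \<Rightarrow> ('a \<Rightarrow> 'b::real_normed_vector) \<Rightarrow> bool" where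
  "C_k_on 0 S f \<longleftrightarrow> continuous_on S f"
| "C_k_on (Suc k) S f \<longleftrightarrow>
     (\<forall>x\<in>S. f differentiable (at x)) \<and>
     (\<forall>v. C_k_on k S (\<lambda>x. frechet_derivative f (at x) v))"

definition smooth_on ::
  "'a::real_normed_vector set \<Rightarrow> ('a \<Rightarrow> 'b::real_normed_vector) \<Rightarrow> bool" where
  "smooth_on S f \<longleftrightarrow> (\<forall>k. C_k_on k S f)"

definition partial :: "'n \<Rightarrow> (real^'n::finite \<Rightarrow> real) \<Rightarrow> real^'n \<Rightarrow> real" where
  "partial i f x = frechet_derivative f (at x) (axis i 1)"


section \<open>Smooth manifolds\<close>

text \<open>A manifold is a Hausdorff second countable type together with a maximal smooth atlas.
  A chart is a domain together with a coordinate map; values outside the domain are irrelevant.\<close>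

type_synonym ('m, 'n) chart = "'m set \<times> ('m \<Rightarrow> real^'n)"

definition chart_range :: "('m, 'n::finite) chart \<Rightarrow> (real^'n) set" where
  "chart_range c = snd c ` fst c"

definition chart_inv :: "('m, 'n::finite) chart \<Rightarrow> real^'n \<Rightarrow> 'm" where
  "chart_inv c = inv_into (fst c) (snd c)"

definition is_chart :: "('m::topological_space, 'n::finite) chart \<Rightarrow> bool" where
  "is_chart c \<longleftrightarrow> open (fst c) \<and> open (chart_range c) \<and>
     homeomorphism (fst c) (chart_range c) (snd c) (chart_inv c)"

definition transition ::
  "('m, 'n::finite) chart \<Rightarrow> ('m, 'n) chart \<Rightarrow> real^'n \<Rightarrow> real^'n" where
  "transition c c' = snd c' \<circ> chart_inv c"

text \<open>The part of the coordinate range of \<open>c\<close> that is also covered by \<open>c'\<close>.\<close>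

definition overlap :: "('m, 'n::finite) chart \<Rightarrow> ('m, 'n) chart \<Rightarrow> (real^'n) set" where
  "overlap c c' = snd c ` (fst c \<inter> fst c')"

definition compatible :: "('m, 'n::finite) chart \<Rightarrow> ('m, 'n) chart \<Rightarrow> bool" where
  "compatible c c' \<longleftrightarrow>
     smooth_on (overlap c c') (transition c c') \<and> smooth_on (overlap c' c) (transition c' c)"

definition smooth_structure ::
  "('m::{t2_space, second_countable_topology}, 'n::finite) chart set \<Rightarrow> bool" where
  "smooth_structure \<A> \<longleftrightarrow>
     (\<forall>c\<in>\<A>. is_chart c) \<and> \<Union> (fst ` \<A>) = UNIV \<and>
     (\<forall>c\<in>\<A>. \<forall>c'\<in>\<A>. compatible c c') \<and>
     (\<forall>c. is_chart c \<and> (\<forall>c'\<in>\<A>. compatible c c') \<longrightarrow> c \<in> \<A>)"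


section \<open>The 1-jet bundle\<close>

definition local_rep ::
  "('a, 'p::finite) chart \<Rightarrow> ('b, 'n::finite) chart \<Rightarrow> ('a \<Rightarrow> 'b) \<Rightarrow> real^'p \<Rightarrow> real^'n" where
  "local_rep c d f = snd d \<circ> f \<circ> chart_inv c"

definition smooth_near ::
  "('a::topological_space, 'p::finite) chart set \<Rightarrow> ('b::topological_space, 'n::finite) chart set
     \<Rightarrow> ('a \<Rightarrow> 'b) \<Rightarrow> 'a \<Rightarrow> bool" where
  "smooth_near \<A> \<B> f a \<longleftrightarrow>
     (\<exists>N. open N \<and> a \<in> N \<and> continuous_on N f \<and>
        (\<forall>c\<in>\<A>. \<forall>d\<in>\<B>. smooth_on (snd c ` (fst c \<inter> N \<inter> f -` fst d)) (local_rep c d f)))"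

text \<open>The 1-jet of \<open>f\<close> at \<open>a\<close>: the base point together with the class of all maps, smooth near
  \<open>a\<close>, that agree with \<open>f\<close> to first order at \<open>a\<close>.\<close>

definition jet ::
  "('a::topological_space, 'p::finite) chart set \<Rightarrow> ('b::topological_space, 'n::finite) chart set
     \<Rightarrow> ('a \<Rightarrow> 'b) \<Rightarrow> 'a \<Rightarrow> 'a \<times> ('a \<Rightarrow> 'b) set" where
  "jet \<A> \<B> f a = (a, {f'. smooth_near \<A> \<B> f' a \<and> f' a = f a \<and>
     (\<forall>c\<in>\<A>. \<forall>d\<in>\<B>. a \<in> fst c \<and> f a \<in> fst d \<longrightarrow>
        jacobian (local_rep c d f') (at (snd c a)) = jacobian (local_rep c d f) (at (snd c a)))})"

text \<open>Induced coordinates \<open>(t, x, y)\<close> on the jet bundle, where \<open>y $ i $ \<alpha>\<close> is the coordinate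
  \<open>x\<^sup>i\<^sub>\<alpha> = \<partial>x\<^sup>i/\<partial>t\<^sup>\<alpha>\<close>.\<close>

type_synonym ('p, 'n) jet_coord = "(real^'p) \<times> (real^'n) \<times> (real^'p^'n)"

definition jet_coords ::
  "('a, 'p::finite) chart \<Rightarrow> ('b, 'n::finite) chart \<Rightarrow> ('a \<Rightarrow> 'b) \<Rightarrow> 'a \<Rightarrow> ('p, 'n) jet_coord" where
  "jet_coords c d f a = (snd c a, snd d (f a), jacobian (local_rep c d f) (at (snd c a)))"


section \<open>Tensors given by their components\<close>

text \<open>The index of a symmetric bilinear form: the largest dimension of a subspace on which it is
  negative definite. Semi-Riemannian metrics are required to have constant index.\<close>

definition form_index :: "real^'n^'n::finite \<Rightarrow> nat" where
  "form_index A = Max {dim S | S. subspace S \<and> (\<forall>v\<in>S. v \<noteq> 0 \<longrightarrow> v \<bullet> (A *v v) < 0)}"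

text \<open>\<open>g c x $ i $ j\<close> is \<open>g\<^sub>i\<^sub>j\<close> in the chart \<open>c\<close>, as a function of the coordinates \<open>x\<close>.\<close>

definition semi_riemannian_metric ::
  "('m, 'n::finite) chart set \<Rightarrow> (('m, 'n) chart \<Rightarrow> real^'n \<Rightarrow> real^'n^'n) \<Rightarrow> bool" where
  "semi_riemannian_metric \<A> g \<longleftrightarrow>
     (\<forall>c\<in>\<A>. smooth_on (chart_range c) (g c)) \<and>
     (\<forall>c\<in>\<A>. \<forall>x\<in>chart_range c. transpose (g c x) = g c x \<and> invertible (g c x)) \<and>
     (\<exists>\<nu>. \<forall>c\<in>\<A>. \<forall>x\<in>chart_range c. form_index (g c x) = \<nu>) \<and>
     (\<forall>c\<in>\<A>. \<forall>c'\<in>\<A>. \<forall>x\<in>overlap c c'. \<forall>i j.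
        g c x $ i $ j =
          (\<Sum>k\<in>UNIV. \<Sum>l\<in>UNIV. jacobian (transition c c') (at x) $ k $ i *
             jacobian (transition c c') (at x) $ l $ j * g c' (transition c c' x) $ k $ l))"

text \<open>A d-tensor on the jet bundle with components \<open>U\<^sup>(\<^sup>\<alpha>\<^sup>)\<^sub>(\<^sub>i\<^sub>)(t, x)\<close>, written
  \<open>U c d t x $ i $ \<alpha>\<close>, which do not depend on the jet directions.\<close>

definition basic_d_tensor ::
  "('a, 'p::finite) chart set \<Rightarrow> ('b, 'n::finite) chart set \<Rightarrow>
     (('a, 'p) chart \<Rightarrow> ('b, 'n) chart \<Rightarrow> real^'p \<Rightarrow> real^'n \<Rightarrow> real^'p^'n) \<Rightarrow> bool" where
  "basic_d_tensor \<A> \<B> U \<longleftrightarrow>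
     (\<forall>c\<in>\<A>. \<forall>d\<in>\<B>. smooth_on (chart_range c \<times> chart_range d) (\<lambda>(t, x). U c d t x)) \<and>
     (\<forall>c\<in>\<A>. \<forall>c'\<in>\<A>. \<forall>d\<in>\<B>. \<forall>d'\<in>\<B>. \<forall>t\<in>overlap c c'. \<forall>x\<in>overlap d d'. \<forall>i \<alpha>.
        U c d t x $ i $ \<alpha> =
          (\<Sum>\<beta>\<in>UNIV. \<Sum>j\<in>UNIV.
             jacobian (transition c' c) (at (transition c c' t)) $ \<alpha> $ \<beta> *
             jacobian (transition d d') (at x) $ j $ i *
             U c' d' (transition c c' t) (transition d d' x) $ j $ \<beta>))"

definition smooth_function ::
  "('a, 'p::finite) chart set \<Rightarrow> ('b, 'n::finite) chart set \<Rightarrow> ('a \<Rightarrow> 'b \<Rightarrow> real) \<Rightarrow> bool" where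
  "smooth_function \<A> \<B> F \<longleftrightarrow>
     (\<forall>c\<in>\<A>. \<forall>d\<in>\<B>. smooth_on (chart_range c \<times> chart_range d)
        (\<lambda>(t, x). F (chart_inv c t) (chart_inv d x)))"


section \<open>Autonomous metrical multi-time Lagrange spaces of electrodynamics\<close>

text \<open>\<open>\<A>\<close> and \<open>\<B>\<close> are the smooth structures of \<open>T\<close> and \<open>M\<close>; the Lagrangian \<open>L\<close> is a function
  of 1-jets. Only the values of \<open>L\<close> on jets of maps that are smooth near the base point matter.\<close>

definition EDML_space ::
  "('a::{t2_space, second_countable_topology}, 'p::finite) chart set \<Rightarrow>
   ('b::{t2_space, second_countable_topology}, 'n::finite) chart set \<Rightarrow>
   (('a, 'p) chart \<Rightarrow> real^'p \<Rightarrow> real^'p^'p) \<Rightarrow>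
   (('b, 'n) chart \<Rightarrow> real^'n \<Rightarrow> real^'n^'n) \<Rightarrow>
   (('a, 'p) chart \<Rightarrow> ('b, 'n) chart \<Rightarrow> real^'p \<Rightarrow> real^'n \<Rightarrow> real^'p^'n) \<Rightarrow>
   ('a \<Rightarrow> 'b \<Rightarrow> real) \<Rightarrow> ('a \<times> ('a \<Rightarrow> 'b) set \<Rightarrow> real) \<Rightarrow> bool" where
  "EDML_space \<A> \<B> h g U F L \<longleftrightarrow>
     smooth_structure \<A> \<and> smooth_structure \<B> \<and>
     semi_riemannian_metric \<A> h \<and> semi_riemannian_metric \<B> g \<and>
     basic_d_tensor \<A> \<B> U \<and> smooth_function \<A> \<B> F \<and>
     (\<forall>f a. smooth_near \<A> \<B> f a \<longrightarrow>
       (\<forall>c\<in>\<A>. \<forall>d\<in>\<B>. a \<in> fst c \<and> f a \<in> fst d \<longrightarrow>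
         L (jet \<A> \<B> f a) =
           (case jet_coords c d f a of (t, x, y) \<Rightarrow>
             (\<Sum>\<alpha>\<in>UNIV. \<Sum>\<beta>\<in>UNIV. \<Sum>i\<in>UNIV. \<Sum>j\<in>UNIV.
                matrix_inv (h c t) $ \<alpha> $ \<beta> * g d x $ i $ j * y $ i $ \<alpha> * y $ j $ \<beta>) +
             (\<Sum>\<alpha>\<in>UNIV. \<Sum>i\<in>UNIV. U c d t x $ i $ \<alpha> * y $ i $ \<alpha>) +
             F a (f a))))"


section \<open>Local objects in induced coordinates\<close>

text \<open>From here on \<open>h\<close>, \<open>g\<close> and \<open>U\<close> are the local components in one fixed pair of charts.\<close>

definition pd_t :: "'p \<Rightarrow> (('p::finite, 'n::finite) jet_coord \<Rightarrow> real) \<Rightarrow> ('p, 'n) jet_coord \<Rightarrow> real" where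
  "pd_t \<alpha> f u = frechet_derivative f (at u) (axis \<alpha> 1, 0, 0)"

definition pd_x :: "'n \<Rightarrow> (('p::finite, 'n::finite) jet_coord \<Rightarrow> real) \<Rightarrow> ('p, 'n) jet_coord \<Rightarrow> real" where
  "pd_x i f u = frechet_derivative f (at u) (0, axis i 1, 0)"

definition pd_y :: "'n \<Rightarrow> 'p \<Rightarrow> (('p::finite, 'n::finite) jet_coord \<Rightarrow> real) \<Rightarrow> ('p, 'n) jet_coord \<Rightarrow> real" where
  "pd_y i \<alpha> f u = frechet_derivative f (at u) (0, 0, axis i (axis \<alpha> 1))"

text \<open>\<open>christoffel g k i j\<close> is the symbol of the second kind with upper index \<open>k\<close>.\<close>

definition christoffel ::
  "(real^'n \<Rightarrow> real^'n^'n::finite) \<Rightarrow> 'n \<Rightarrow> 'n \<Rightarrow> 'n \<Rightarrow> real^'n \<Rightarrow> real" where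
  "christoffel g k i j x =
     1/2 * (\<Sum>m\<in>UNIV. matrix_inv (g x) $ k $ m *
       (partial i (\<lambda>z. g z $ m $ j) x + partial j (\<lambda>z. g z $ m $ i) x
        - partial m (\<lambda>z. g z $ i $ j) x))"

text \<open>\<open>U\<^sup>(\<^sup>\<alpha>\<^sup>)\<^sub>(\<^sub>i\<^sub>)\<^sub>j\<close>\<close>

definition U_curl ::
  "(real^'p::finite \<Rightarrow> real^'n \<Rightarrow> real^'p^'n::finite) \<Rightarrow> 'p \<Rightarrow> 'n \<Rightarrow> 'n \<Rightarrow> real^'p \<Rightarrow> real^'n \<Rightarrow> real" where
  "U_curl U \<alpha> i j t x = partial j (\<lambda>z. U t z $ i $ \<alpha>) x - partial i (\<lambda>z. U t z $ j $ \<alpha>) x"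

text \<open>The canonical nonlinear connection: \<open>M_conn h i \<alpha> \<beta>\<close> is \<open>M\<^sup>(\<^sup>i\<^sup>)\<^sub>(\<^sub>\<alpha>\<^sub>)\<^sub>\<beta>\<close> and
  \<open>N_conn h g U i \<alpha> j\<close> is \<open>N\<^sup>(\<^sup>i\<^sup>)\<^sub>(\<^sub>\<alpha>\<^sub>)\<^sub>j\<close>.\<close>

definition M_conn ::
  "(real^'p \<Rightarrow> real^'p^'p) \<Rightarrow> 'n \<Rightarrow> 'p \<Rightarrow> 'p \<Rightarrow> ('p::finite, 'n::finite) jet_coord \<Rightarrow> real" where
  "M_conn h i \<alpha> \<beta> = (\<lambda>(t, x, y). - (\<Sum>\<gamma>\<in>UNIV. christoffel h \<gamma> \<alpha> \<beta> t * y $ i $ \<gamma>))"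

definition N_conn ::
  "(real^'p \<Rightarrow> real^'p^'p) \<Rightarrow> (real^'n \<Rightarrow> real^'n^'n) \<Rightarrow> (real^'p \<Rightarrow> real^'n \<Rightarrow> real^'p^'n) \<Rightarrow>
     'n \<Rightarrow> 'p \<Rightarrow> 'n \<Rightarrow> ('p::finite, 'n::finite) jet_coord \<Rightarrow> real" where
  "N_conn h g U i \<alpha> j = (\<lambda>(t, x, y).
     (\<Sum>k\<in>UNIV. christoffel g i j k x * y $ k $ \<alpha>) +
     (\<Sum>\<gamma>\<in>UNIV. \<Sum>l\<in>UNIV. h t $ \<alpha> $ \<gamma> * matrix_inv (g x) $ i $ l / 4 * U_curl U \<gamma> l j t x))"

definition delta_t ::
  "(real^'p \<Rightarrow> real^'p^'p) \<Rightarrow> 'p \<Rightarrow>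
     (('p::finite, 'n::finite) jet_coord \<Rightarrow> real) \<Rightarrow> ('p, 'n) jet_coord \<Rightarrow> real" where
  "delta_t h \<alpha> f u =
     pd_t \<alpha> f u - (\<Sum>j\<in>UNIV. \<Sum>\<beta>\<in>UNIV. M_conn h j \<beta> \<alpha> u * pd_y j \<beta> f u)"

definition delta_x ::
  "(real^'p \<Rightarrow> real^'p^'p) \<Rightarrow> (real^'n \<Rightarrow> real^'n^'n) \<Rightarrow> (real^'p \<Rightarrow> real^'n \<Rightarrow> real^'p^'n) \<Rightarrow>
     'n \<Rightarrow> (('p::finite, 'n::finite) jet_coord \<Rightarrow> real) \<Rightarrow> ('p, 'n) jet_coord \<Rightarrow> real" where
  "delta_x h g U i f u =
     pd_x i f u - (\<Sum>j\<in>UNIV. \<Sum>\<beta>\<in>UNIV. N_conn h g U j \<beta> i u * pd_y j \<beta> f u)"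

text \<open>Covariant derivatives of the Cartan canonical connection: \<open>y_cov_x h g U i \<alpha> j\<close> is
  \<open>x\<^sup>i\<^sub>\<alpha>\<^sub>|\<^sub>j\<close>; for a d-tensor with components \<open>E \<alpha> i j\<close>, the remaining three are the derivatives
  with indices \<open>/\<beta>\<close>, \<open>|k\<close> and \<open>|\<^sup>(\<^sup>\<gamma>\<^sup>)\<^sub>(\<^sub>k\<^sub>)\<close>.\<close>

definition y_cov_x ::
  "(real^'p \<Rightarrow> real^'p^'p) \<Rightarrow> (real^'n \<Rightarrow> real^'n^'n) \<Rightarrow> (real^'p \<Rightarrow> real^'n \<Rightarrow> real^'p^'n) \<Rightarrow>
     'n \<Rightarrow> 'p \<Rightarrow> 'n \<Rightarrow> ('p::finite, 'n::finite) jet_coord \<Rightarrow> real" where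
  "y_cov_x h g U i \<alpha> j = (\<lambda>(t, x, y).
     delta_x h g U j (\<lambda>(t', x', y'). y' $ i $ \<alpha>) (t, x, y) +
     (\<Sum>k\<in>UNIV. y $ k $ \<alpha> * christoffel g i k j x))"

definition cov_t ::
  "(real^'p \<Rightarrow> real^'p^'p) \<Rightarrow> ('p \<Rightarrow> 'n \<Rightarrow> 'n \<Rightarrow> ('p, 'n) jet_coord \<Rightarrow> real) \<Rightarrow>
     'p \<Rightarrow> 'n \<Rightarrow> 'n \<Rightarrow> 'p \<Rightarrow> ('p::finite, 'n::finite) jet_coord \<Rightarrow> real" where
  "cov_t h E \<alpha> i j \<beta> = (\<lambda>(t, x, y).
     delta_t h \<beta> (E \<alpha> i j) (t, x, y) +
     (\<Sum>\<mu>\<in>UNIV. E \<mu> i j (t, x, y) * christoffel h \<alpha> \<mu> \<beta> t))"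

definition cov_x ::
  "(real^'p \<Rightarrow> real^'p^'p) \<Rightarrow> (real^'n \<Rightarrow> real^'n^'n) \<Rightarrow> (real^'p \<Rightarrow> real^'n \<Rightarrow> real^'p^'n) \<Rightarrow>
     ('p \<Rightarrow> 'n \<Rightarrow> 'n \<Rightarrow> ('p, 'n) jet_coord \<Rightarrow> real) \<Rightarrow>
     'p \<Rightarrow> 'n \<Rightarrow> 'n \<Rightarrow> 'n \<Rightarrow> ('p::finite, 'n::finite) jet_coord \<Rightarrow> real" where
  "cov_x h g U E \<alpha> i j k = (\<lambda>(t, x, y).
     delta_x h g U k (E \<alpha> i j) (t, x, y)
     - (\<Sum>m\<in>UNIV. E \<alpha> m j (t, x, y) * christoffel g m i k x)
     - (\<Sum>m\<in>UNIV. E \<alpha> i m (t, x, y) * christoffel g m j k x))"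

definition cov_y ::
  "('p \<Rightarrow> 'n \<Rightarrow> 'n \<Rightarrow> ('p, 'n) jet_coord \<Rightarrow> real) \<Rightarrow>
     'p \<Rightarrow> 'n \<Rightarrow> 'n \<Rightarrow> 'p \<Rightarrow> 'n \<Rightarrow> ('p::finite, 'n::finite) jet_coord \<Rightarrow> real" where
  "cov_y E \<alpha> i j \<gamma> k = pd_y k \<gamma> (E \<alpha> i j)"

text \<open>The deflection d-tensor \<open>D\<^sup>(\<^sup>\<alpha>\<^sup>)\<^sub>(\<^sub>i\<^sub>)\<^sub>j\<close>, the electromagnetic d-tensor \<open>F\<^sup>(\<^sup>\<alpha>\<^sup>)\<^sub>(\<^sub>i\<^sub>)\<^sub>j\<close> and the torsion
  component \<open>R\<^sup>(\<^sup>m\<^sup>)\<^sub>(\<^sub>\<mu>\<^sub>)\<^sub>\<alpha>\<^sub>j\<close>.\<close>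

definition deflection ::
  "(real^'p \<Rightarrow> real^'p^'p) \<Rightarrow> (real^'n \<Rightarrow> real^'n^'n) \<Rightarrow> (real^'p \<Rightarrow> real^'n \<Rightarrow> real^'p^'n) \<Rightarrow>
     'p \<Rightarrow> 'n \<Rightarrow> 'n \<Rightarrow> ('p::finite, 'n::finite) jet_coord \<Rightarrow> real" where
  "deflection h g U \<alpha> i j = (\<lambda>(t, x, y).
     \<Sum>\<mu>\<in>UNIV. \<Sum>m\<in>UNIV. matrix_inv (h t) $ \<alpha> $ \<mu> * g x $ i $ m * y_cov_x h g U m \<mu> j (t, x, y))"

definition em_tensor ::
  "(real^'p \<Rightarrow> real^'p^'p) \<Rightarrow> (real^'n \<Rightarrow> real^'n^'n) \<Rightarrow> (real^'p \<Rightarrow> real^'n \<Rightarrow> real^'p^'n) \<Rightarrow>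
     'p \<Rightarrow> 'n \<Rightarrow> 'n \<Rightarrow> ('p::finite, 'n::finite) jet_coord \<Rightarrow> real" where
  "em_tensor h g U \<alpha> i j u = 1/2 * (deflection h g U \<alpha> i j u - deflection h g U \<alpha> j i u)"

definition torsion_R ::
  "(real^'p \<Rightarrow> real^'p^'p) \<Rightarrow> (real^'n \<Rightarrow> real^'n^'n) \<Rightarrow> (real^'p \<Rightarrow> real^'n \<Rightarrow> real^'p^'n) \<Rightarrow>
     'n \<Rightarrow> 'p \<Rightarrow> 'p \<Rightarrow> 'n \<Rightarrow> ('p::finite, 'n::finite) jet_coord \<Rightarrow> real" where
  "torsion_R h g U m \<mu> \<alpha> j u =
     delta_x h g U j (M_conn h m \<mu> \<alpha>) u - delta_t h \<alpha> (N_conn h g U m \<mu> j) u"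

definition alternate_sum :: "('n \<Rightarrow> 'n \<Rightarrow> real) \<Rightarrow> 'n \<Rightarrow> 'n \<Rightarrow> real" where
  "alternate_sum S i j = S i j - S j i"

definition cyclic_sum :: "('n \<Rightarrow> 'n \<Rightarrow> 'n \<Rightarrow> real) \<Rightarrow> 'n \<Rightarrow> 'n \<Rightarrow> 'n \<Rightarrow> real" where
  "cyclic_sum S i j k = S i j k + S j k i + S k i j"

end

theory Submission
  imports Defs
begin

text \<open>The part of \<open>N\<close> that is linear in \<open>y\<close> cancels in \<open>x\<^sup>i\<^sub>\<alpha>\<^sub>|\<^sub>j\<close>, and contracting with \<open>h\<close> and \<open>g\<close>
  undoes the remaining inverse metrics, so that the electromagnetic tensor is \<open>-1/4\<close> times the
  \<open>x\<close>-curl of \<open>U\<close>. It does not depend on \<open>y\<close>, which is the third equation. The curl is closed by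
  the symmetry of second derivatives, and the Christoffel terms cancel in the cyclic sum, which is
  the second one. For the first, metric compatibility of the Christoffel symbols of \<open>h\<close> turns the
  torsion component into \<open>-1/4 h\<^sub>\<mu>\<^sub>\<eta> g\<^sup>m\<^sup>k\<close> applied to the \<open>t\<close>-covariant derivative of the curl.\<close>

section \<open>Smooth maps\<close>

lemma differentiable_transform_open:
  assumes "open S" "x \<in> S" "\<And>z. z \<in> S \<Longrightarrow> f z = g z" "f differentiable (at x)"
  shows "g differentiable (at x)"
proof -
  obtain D where "(f has_derivative D) (at x)"
    using assms(4) unfolding differentiable_def by blast
  from has_derivative_transform_within_open[OF this assms(1-3)] show ?thesis
    unfolding differentiable_def by blast
qed

text \<open>On an open set a derivative at a point sees only nearby values, so agreement on
  \<open>S\<close> passes to all directional derivatives and the induction hypothesis applies to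
  these. Hence \<open>f\<close> and \<open>g\<close> vary in the induction.\<close>

lemma C_k_on_cong:
  assumes "open S" "\<And>x. x \<in> S \<Longrightarrow> f x = g x" "C_k_on k S f"
  shows "C_k_on k S g"
  using assms(2,3)
proof (induction k arbitrary: f g)
  case 0
  then show ?case by (simp cong: continuous_on_cong)
next
  case (Suc k)
  have diff: "f differentiable (at x)" if "x \<in> S" for x
    using Suc.prems that by simp
  have eq: "frechet_derivative f (at x) = frechet_derivative g (at x)" if "x \<in> S" for x
    using frechet_derivative_transform_within_open[OF diff[OF that] \<open>open S\<close> that] Suc.prems(1) by blast
  have "g differentiable (at x)" if "x \<in> S" for x
    using differentiable_transform_open[OF \<open>open S\<close> that Suc.prems(1) diff[OF that]] .
  moreover have "C_k_on k S (\<lambda>x. frechet_derivative g (at x) v)" for v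
    by (rule Suc.IH[of "\<lambda>x. frechet_derivative f (at x) v"]) (use Suc.prems eq in auto)
  ultimately show ?case by simp
qed

lemma frechet_derivative_bounded_linear:
  assumes "bounded_linear L" "f differentiable (at x)"
  shows "frechet_derivative (\<lambda>x. L (f x)) (at x) v = L (frechet_derivative f (at x) v)"
proof -
  have "((\<lambda>x. L (f x)) has_derivative (\<lambda>v. L (frechet_derivative f (at x) v))) (at x)"
    using assms bounded_linear.has_derivative frechet_derivative_works by blast
  from frechet_derivative_at[OF this] show ?thesis by metis
qed

text \<open>A bounded linear map commutes with differentiation, so each derivative of the composite
  is again \<open>L\<close> applied to a derivative of \<open>f\<close>. This is what makes the
  components of smooth tensor fields smooth.\<close>

lemma C_k_on_bounded_linear:
  assumes "open S" "bounded_linear L" "C_k_on k S f"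
  shows "C_k_on k S (\<lambda>x. L (f x))"
  using assms(3)
proof (induction k arbitrary: f)
  case 0
  then show ?case
    using assms(2) by (simp add: bounded_linear.continuous_on)
next
  case (Suc k)
  have diff: "f differentiable (at x)" if "x \<in> S" for x
    using Suc.prems that by simp
  have "(\<lambda>x. L (f x)) differentiable (at x)" if "x \<in> S" for x
    using diff[OF that] bounded_linear.has_derivative[OF assms(2)]
    unfolding differentiable_def by blast
  moreover have "C_k_on k S (\<lambda>x. frechet_derivative (\<lambda>x. L (f x)) (at x) v)" for v
  proof (rule C_k_on_cong[OF \<open>open S\<close> _ Suc.IH[of "\<lambda>x. frechet_derivative f (at x) v"]])
    show "L (frechet_derivative f (at x) v) = frechet_derivative (\<lambda>x. L (f x)) (at x) v"
      if "x \<in> S" for x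
      using frechet_derivative_bounded_linear[OF assms(2) diff[OF that]] by simp
  qed (use Suc.prems in simp)
  ultimately show ?case by simp
qed

lemma smooth_on_differentiable:
  "smooth_on S f \<Longrightarrow> x \<in> S \<Longrightarrow> f differentiable (at x)"
  unfolding smooth_on_def by (metis C_k_on.simps(2))

lemma smooth_on_frechet_derivative:
  "smooth_on S f \<Longrightarrow> smooth_on S (\<lambda>x. frechet_derivative f (at x) v)"
  unfolding smooth_on_def by (metis C_k_on.simps(2))

lemma smooth_on_nth_nth:
  fixes f :: "'a::real_normed_vector \<Rightarrow> real^'m^'n"
  assumes "open S" "smooth_on S f"
  shows "smooth_on S (\<lambda>x. f x $ i $ j)"
  using assms C_k_on_bounded_linear[where L = "\<lambda>A :: real^'m^'n. A $ i $ j"]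
    bounded_linear_compose[OF bounded_linear_vec_nth bounded_linear_vec_nth]
  unfolding smooth_on_def by blast

text \<open>By the mean value theorem in the direction of the first vector.\<close>

lemma second_difference_tendsto:
  fixes f :: "'a::real_normed_vector \<Rightarrow> real"
  assumes "open S" "x \<in> S"
    and diff: "\<And>z. z \<in> S \<Longrightarrow> f differentiable (at z)"
    and diff2: "((\<lambda>z. frechet_derivative f (at z) v) has_derivative D) (at x)"
  shows "((\<lambda>s. (f (x + s *\<^sub>R v + s *\<^sub>R w) - f (x + s *\<^sub>R v) - f (x + s *\<^sub>R w) + f x) / s^2)
            \<longlongrightarrow> D w) (at_right 0)"
proof -
  let ?\<Delta> = "\<lambda>s. f (x + s *\<^sub>R v + s *\<^sub>R w) - f (x + s *\<^sub>R v) - f (x + s *\<^sub>R w) + f x"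
  let ?fv = "\<lambda>z. frechet_derivative f (at z) v"
  \<comment> \<open>The summand 1 keeps \<open>K\<close> positive even for zero directions, so that
    it may be divided by.\<close>
  define K where "K = norm v + norm w + 1"
  have K: "K > 0" "norm v \<le> K" "norm w \<le> K"
    unfolding K_def by (auto intro: add_nonneg_pos)
  interpret D: bounded_linear D
    using diff2 by (rule has_derivative_bounded_linear)
  obtain r where r: "r > 0" "ball x r \<subseteq> S"
    using assms(1,2) openE by blast
  \<comment> \<open>Chain rule along the line through \<open>p\<close> in direction
    \<open>v\<close>; it provides the derivatives for the mean value theorem below.\<close>
  have line: "((\<lambda>\<sigma>. f (p + \<sigma> *\<^sub>R v)) has_real_derivative ?fv (p + \<sigma> *\<^sub>R v)) (at \<sigma>)"
    if "p + \<sigma> *\<^sub>R v \<in> S" for p \<sigma>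
  proof -
    interpret F: bounded_linear "frechet_derivative f (at (p + \<sigma> *\<^sub>R v))"
      using diff[OF that] frechet_derivative_works has_derivative_bounded_linear by blast
    have "((f \<circ> (\<lambda>\<sigma>. p + \<sigma> *\<^sub>R v)) has_derivative
        frechet_derivative f (at (p + \<sigma> *\<^sub>R v)) \<circ> (\<lambda>d. d *\<^sub>R v)) (at \<sigma>)"
      by (rule diff_chain_at)
        (auto intro!: derivative_eq_intros simp flip: frechet_derivative_works simp: diff that)
    then show ?thesis
      by (auto simp: has_field_derivative_def o_def F.scaleR mult.commute
          elim!: has_derivative_eq_rhs)
  qed
  show ?thesis
  proof (rule tendstoI)
    fix e :: real assume "e > 0"
    \<comment> \<open>The linear approximation of \<open>?fv\<close> is used at two points, each
      with error at most \<open>\<epsilon> * (2 * K * s)\<close>; with this choice the total is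
      \<open>s * (e / 2)\<close>.\<close>
    define \<epsilon> where "\<epsilon> = e / (8 * K)"
    have "\<epsilon> > 0" using \<open>e > 0\<close> K by (simp add: \<epsilon>_def)
    obtain d where d: "d > 0"
      "\<And>z. norm (z - x) < d \<Longrightarrow> \<bar>?fv z - ?fv x - D (z - x)\<bar> \<le> \<epsilon> * norm (z - x)"
      using diff2 \<open>\<epsilon> > 0\<close> unfolding has_derivative_at_alt real_norm_def by blast
    \<comment> \<open>For \<open>s < s0\<close> the whole parallelogram spanned at \<open>x\<close>
      by \<open>s *\<^sub>R v\<close> and \<open>s *\<^sub>R w\<close> stays in \<open>S\<close> and
      in the region where the linear approximation of \<open>?fv\<close> holds.\<close>
    define s0 where "s0 = min r d / (2 * K)"
    have "s0 > 0" using r d K by (simp add: s0_def)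
    have "dist (?\<Delta> s / s^2) (D w) < e" if s: "0 < s" "s < s0" for s
    proof -
      have s2: "2 * K * s < r" "2 * K * s < d"
        using s K unfolding s0_def by (auto simp: field_simps min_def split: if_splits)
      have bound: "norm (\<sigma> *\<^sub>R v + \<tau> *\<^sub>R w) \<le> 2 * K * s"
        if "0 \<le> \<sigma>" "\<sigma> \<le> s" "0 \<le> \<tau>" "\<tau> \<le> s" for \<sigma> \<tau>
      proof -
        have "\<sigma> * norm v \<le> s * K" "\<tau> * norm w \<le> s * K"
          using that K s by (auto intro!: mult_mono)
        then have "norm (\<sigma> *\<^sub>R v) \<le> s * K" "norm (\<tau> *\<^sub>R w) \<le> s * K"
          using that by auto
        then have "norm (\<sigma> *\<^sub>R v + \<tau> *\<^sub>R w) \<le> s * K + s * K"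
          by (rule norm_triangle_mono)
        then show ?thesis by (simp add: mult_ac)
      qed
      have inS: "x + \<tau> *\<^sub>R w + \<sigma> *\<^sub>R v \<in> S"
        if "0 \<le> \<sigma>" "\<sigma> \<le> s" "0 \<le> \<tau>" "\<tau> \<le> s" for \<sigma> \<tau>
      proof (rule subsetD[OF r(2)])
        have "x + \<tau> *\<^sub>R w + \<sigma> *\<^sub>R v = x + (\<sigma> *\<^sub>R v + \<tau> *\<^sub>R w)" by simp
        then have "dist (x + \<tau> *\<^sub>R w + \<sigma> *\<^sub>R v) x = norm (\<sigma> *\<^sub>R v + \<tau> *\<^sub>R w)"
          by (simp add: dist_norm add.commute)
        then show "x + \<tau> *\<^sub>R w + \<sigma> *\<^sub>R v \<in> ball x r"
          using bound[OF that] s2 by (simp add: dist_commute)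
      qed
      have approx: "\<bar>?fv (x + \<tau> *\<^sub>R w + \<sigma> *\<^sub>R v) - ?fv x - (\<sigma> * D v + \<tau> * D w)\<bar> \<le> \<epsilon> * (2 * K * s)"
        if "0 \<le> \<sigma>" "\<sigma> \<le> s" "0 \<le> \<tau>" "\<tau> \<le> s" for \<sigma> \<tau>
      proof -
        have eq: "x + \<tau> *\<^sub>R w + \<sigma> *\<^sub>R v - x = \<sigma> *\<^sub>R v + \<tau> *\<^sub>R w" by simp
        have "\<bar>?fv (x + \<tau> *\<^sub>R w + \<sigma> *\<^sub>R v) - ?fv x - D (\<sigma> *\<^sub>R v + \<tau> *\<^sub>R w)\<bar>
            \<le> \<epsilon> * norm (\<sigma> *\<^sub>R v + \<tau> *\<^sub>R w)"
          using d(2)[of "x + \<tau> *\<^sub>R w + \<sigma> *\<^sub>R v"] bound[OF that] s2 unfolding eq by linarith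
        also have "\<dots> \<le> \<epsilon> * (2 * K * s)"
          using bound[OF that] \<open>\<epsilon> > 0\<close> by simp
        finally show ?thesis by (simp add: D.add D.scaleR)
      qed
      \<comment> \<open>The double difference is the increment over \<open>[0, s]\<close> of the
        single difference \<open>f (x + s *\<^sub>R w + \<xi> *\<^sub>R v) - f (x + \<xi> *\<^sub>R
        v)\<close>, regarded as a function of \<xi>.\<close>
      have "\<exists>\<xi>. 0 < \<xi> \<and> \<xi> < s \<and>
          (f (x + s *\<^sub>R w + s *\<^sub>R v) - f (x + s *\<^sub>R v)) - (f (x + s *\<^sub>R w + 0 *\<^sub>R v) - f (x + 0 *\<^sub>R v))
          = (s - 0) * (?fv (x + s *\<^sub>R w + \<xi> *\<^sub>R v) - ?fv (x + \<xi> *\<^sub>R v))"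
      proof (rule MVT2[OF \<open>0 < s\<close>])
        fix \<xi> assume "0 \<le> \<xi>" "\<xi> \<le> s"
        then show "((\<lambda>\<xi>. f (x + s *\<^sub>R w + \<xi> *\<^sub>R v) - f (x + \<xi> *\<^sub>R v)) has_real_derivative
            ?fv (x + s *\<^sub>R w + \<xi> *\<^sub>R v) - ?fv (x + \<xi> *\<^sub>R v)) (at \<xi>)"
          using inS[of \<xi> s] inS[of \<xi> 0] s by (intro DERIV_diff line) auto
      qed
      then obtain \<xi> where \<xi>: "0 < \<xi>" "\<xi> < s"
        and \<Delta>: "?\<Delta> s = s * (?fv (x + s *\<^sub>R w + \<xi> *\<^sub>R v) - ?fv (x + \<xi> *\<^sub>R v))"
        by (auto simp: algebra_simps)
      let ?q = "?fv (x + s *\<^sub>R w + \<xi> *\<^sub>R v) - ?fv (x + \<xi> *\<^sub>R v)"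
      \<comment> \<open>The terms \<open>?fv x\<close> and \<open>\<xi> * D v\<close> occur in both
        expansions and cancel, so the unknown \<xi> drops out.\<close>
      have "\<bar>?q - s * D w\<bar> \<le> 2 * (\<epsilon> * (2 * K * s))"
        using approx[of \<xi> s] approx[of \<xi> 0] \<xi> s by simp
      also have "\<dots> = s * (e / 2)"
        using K by (simp add: \<epsilon>_def field_simps)
      finally have "\<bar>?q - s * D w\<bar> / s \<le> e / 2"
        using s by (simp add: pos_divide_le_eq mult.commute)
      moreover have "?\<Delta> s / s^2 - D w = (?q - s * D w) / s"
        unfolding \<Delta> using s by (simp add: field_simps power2_eq_square)
      ultimately have "\<bar>?\<Delta> s / s^2 - D w\<bar> \<le> e / 2"
        using s by (simp only: abs_divide abs_of_pos)
      then show ?thesis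
        using \<open>e > 0\<close> unfolding dist_real_def by linarith
    qed
    then show "\<forall>\<^sub>F s in at_right 0. dist (?\<Delta> s / s^2) (D w) < e"
      using \<open>s0 > 0\<close> by (auto simp: eventually_at_right_field)
  qed
qed

text \<open>The second difference is unchanged when \<open>v\<close> and \<open>w\<close> are
  exchanged, while its quotient by \<open>s^2\<close> tends to one mixed derivative or the other
  according to which vector is taken first. Uniqueness of limits identifies them.\<close>

lemma second_derivative_symmetric:
  fixes f :: "'a::real_normed_vector \<Rightarrow> real"
  assumes "open S" "x \<in> S" "smooth_on S f"
  shows "frechet_derivative (\<lambda>z. frechet_derivative f (at z) v) (at x) w =
         frechet_derivative (\<lambda>z. frechet_derivative f (at z) w) (at x) v"
proof -
  have D: "((\<lambda>z. frechet_derivative f (at z) a) has_derivative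
      frechet_derivative (\<lambda>z. frechet_derivative f (at z) a) (at x)) (at x)" for a
    using smooth_on_differentiable[OF smooth_on_frechet_derivative[OF assms(3)] assms(2)]
    by (simp add: frechet_derivative_works)
  note lim = second_difference_tendsto[OF assms(1,2) smooth_on_differentiable[OF assms(3)] D]
  show ?thesis
    using lim[of v w] lim[of w v]
    by (intro tendsto_unique[OF _ lim[of v w]]) (simp_all add: algebra_simps)
qed

section \<open>Christoffel symbols\<close>

lemma differentiable_det:
  fixes A :: "'a::real_normed_vector \<Rightarrow> real^'n^'n::finite"
  assumes "\<And>i j. (\<lambda>x. A x $ i $ j) differentiable (at x)"
  shows "(\<lambda>x. det (A x)) differentiable (at x)"
proof -
  have "(\<lambda>x. \<Prod>i\<in>UNIV. A x $ i $ p i) differentiable (at x)" for p :: "'n \<Rightarrow> 'n"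
  proof -
    have "((\<lambda>x. A x $ i $ p i) has_derivative frechet_derivative (\<lambda>x. A x $ i $ p i) (at x)) (at x)"
      for i
      using assms[of i "p i"] by (simp only: frechet_derivative_works)
    then show ?thesis
      unfolding differentiable_def
      by (intro exI, rule has_derivative_prod[where f = "\<lambda>i x. A x $ i $ p i"])
  qed
  then show ?thesis unfolding det_def
    by (intro differentiable_sum differentiable_mult) auto
qed

lemma matrix_inv_mult:
  fixes A :: "real^'n^'n::finite"
  assumes "invertible A"
  shows "A ** matrix_inv A = mat 1" "matrix_inv A ** A = mat 1"
  using someI_ex[OF assms[unfolded invertible_def]] unfolding matrix_inv_def by auto

text \<open>Cramer's rule for the column of the inverse that solves
  \<open>A *v z = axis l 1\<close>. The quotient of determinants makes differentiability of the
  inverse visible.\<close>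

lemma matrix_inv_nth_nth:
  fixes A :: "real^'n^'n::finite"
  assumes "invertible A"
  shows "matrix_inv A $ k $ l =
    det (\<chi> i j. if j = k then axis l 1 $ i else A $ i $ j) / det A"
proof -
  have "A *v (matrix_inv A *v axis l 1) = axis l 1"
    using assms by (simp add: matrix_vector_mul_assoc matrix_inv_mult(1))
  then have "matrix_inv A *v axis l 1 =
      (\<chi> k. det (\<chi> i j. if j = k then axis l 1 $ i else A $ i $ j) / det A)"
    using cramer assms invertible_det_nz by blast
  moreover have "(matrix_inv A *v axis l 1) $ k = matrix_inv A $ k $ l"
    by (simp add: matrix_vector_mul_component inner_axis)
  ultimately show ?thesis by simp
qed

lemma differentiable_matrix_inv_nth_nth:
  fixes A :: "'a::real_normed_vector \<Rightarrow> real^'n^'n::finite"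
  assumes "open S" "x \<in> S" "smooth_on S A" "\<And>z. z \<in> S \<Longrightarrow> invertible (A z)"
  shows "(\<lambda>z. matrix_inv (A z) $ k $ l) differentiable (at x)"
proof -
  have A: "(\<lambda>z. A z $ i $ j) differentiable (at x)" for i j
    using assms smooth_on_differentiable smooth_on_nth_nth by blast
  have "(\<lambda>z. det (\<chi> i j. if j = k then axis l 1 $ i else A z $ i $ j) / det (A z))
      differentiable (at x)"
  proof (intro differentiable_divide differentiable_det)
    show "(\<lambda>z. (\<chi> i j. if j = k then axis l 1 $ i else A z $ i $ j) $ a $ b) differentiable (at x)"
      for a b by (cases "b = k") (simp_all add: A)
    show "det (A x) \<noteq> 0" using assms(2,4) invertible_det_nz by blast
  qed (rule A)
  then show ?thesis
    \<comment> \<open>Cramer's formula is available at invertible matrices, hence on the open set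
      \<open>S\<close> around \<open>x\<close>.\<close>
    by (rule differentiable_transform_open[OF assms(1,2), rotated])
      (simp add: matrix_inv_nth_nth assms(4))
qed

section \<open>A metric and its Christoffel symbols in one chart\<close>

locale local_metric =
  fixes S :: "(real^'n::finite) set" and g :: "real^'n \<Rightarrow> real^'n^'n"
  assumes open_S: "open S"
    and smooth: "smooth_on S g"
    and symmetric: "x \<in> S \<Longrightarrow> g x $ i $ j = g x $ j $ i"
    and invertible: "x \<in> S \<Longrightarrow> invertible (g x)"
begin

lemma differentiable: "x \<in> S \<Longrightarrow> (\<lambda>z. g z $ i $ j) differentiable (at x)"
  using smooth_on_differentiable smooth_on_nth_nth[OF open_S smooth] by blast

lemma differentiable_partial:
  "x \<in> S \<Longrightarrow> partial k (\<lambda>z. g z $ i $ j) differentiable (at x)"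
  unfolding partial_def
  by (rule smooth_on_differentiable smooth_on_frechet_derivative smooth_on_nth_nth open_S smooth)+

lemma partial_symmetric:
  assumes "x \<in> S"
  shows "partial k (\<lambda>z. g z $ i $ j) x = partial k (\<lambda>z. g z $ j $ i) x"
  unfolding partial_def
  using frechet_derivative_transform_within_open[OF differentiable[OF assms] open_S assms symmetric]
  by simp

text \<open>Vanishing torsion of the Levi-Civita connection: exchanging the lower indices permutes
  the first two terms and fixes the third by symmetry of \<open>g\<close>.\<close>

lemma christoffel_symmetric:
  "x \<in> S \<Longrightarrow> christoffel g k i j x = christoffel g k j i x"
  unfolding christoffel_def using partial_symmetric[of x _ i j] by (simp add: algebra_simps)

lemma matrix_inv_differentiable:
  "x \<in> S \<Longrightarrow> (\<lambda>z. matrix_inv (g z) $ i $ j) differentiable (at x)"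
  using differentiable_matrix_inv_nth_nth[OF open_S _ smooth invertible] .

lemma christoffel_differentiable:
  assumes "x \<in> S"
  shows "christoffel g k i j differentiable (at x)"
  unfolding christoffel_def
  using matrix_inv_differentiable[OF assms] differentiable_partial[OF assms]
  by (intro differentiable_sum differentiable_mult differentiable_diff differentiable_add
      differentiable_const) auto

lemma inverse_contract:
  assumes "x \<in> S"
  shows "(\<Sum>m\<in>UNIV. g x $ i $ m * (\<Sum>l\<in>UNIV. matrix_inv (g x) $ m $ l * f l)) = f i" (is ?A)
    and "(\<Sum>m\<in>UNIV. matrix_inv (g x) $ i $ m * (\<Sum>l\<in>UNIV. g x $ m $ l * f l)) = f i" (is ?B)
proof -
  have "g x *v (matrix_inv (g x) *v (\<chi> l. f l)) = (\<chi> l. f l)"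
    and "matrix_inv (g x) *v (g x *v (\<chi> l. f l)) = (\<chi> l. f l)"
    using matrix_inv_mult[OF invertible[OF assms]] by (simp_all add: matrix_vector_mul_assoc)
  from arg_cong[OF this(1), of "\<lambda>v. v $ i"] arg_cong[OF this(2), of "\<lambda>v. v $ i"] show ?A ?B
    by (simp_all add: matrix_vector_mult_def)
qed

text \<open>Lowering the upper index cancels the inverse metric and leaves the Christoffel symbol of
  the first kind.\<close>

lemma christoffel_lower:
  assumes "x \<in> S"
  shows "(\<Sum>m\<in>UNIV. g x $ l $ m * christoffel g m i j x) =
    1/2 * (partial i (\<lambda>z. g z $ l $ j) x + partial j (\<lambda>z. g z $ l $ i) x
      - partial l (\<lambda>z. g z $ i $ j) x)"
  unfolding christoffel_def
  using inverse_contract(1)[OF assms, of l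
    "\<lambda>l. 1/2 * (partial i (\<lambda>z. g z $ l $ j) x + partial j (\<lambda>z. g z $ l $ i) x
      - partial l (\<lambda>z. g z $ i $ j) x)"]
  by (simp add: sum_distrib_left mult.commute mult.left_commute)

text \<open>Metric compatibility of the Levi-Civita connection. In the sum of the two symbols of the
  first kind, four of the six derivatives cancel and the other two are equal.\<close>

lemma partial_metric:
  assumes "x \<in> S"
  shows "partial k (\<lambda>z. g z $ i $ j) x =
    (\<Sum>m\<in>UNIV. christoffel g m i k x * g x $ m $ j) + (\<Sum>m\<in>UNIV. christoffel g m j k x * g x $ i $ m)"
proof -
  have "(\<Sum>m\<in>UNIV. christoffel g m i k x * g x $ m $ j) =
      (\<Sum>m\<in>UNIV. g x $ j $ m * christoffel g m i k x)"
    by (intro sum.cong refl) (simp add: symmetric[OF assms, of _ j] mult.commute)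
  moreover have "(\<Sum>m\<in>UNIV. christoffel g m j k x * g x $ i $ m) =
      (\<Sum>m\<in>UNIV. g x $ i $ m * christoffel g m j k x)"
    by (simp add: mult.commute)
  ultimately show ?thesis
    using partial_symmetric[OF assms, of _ i j] partial_symmetric[OF assms, of _ i k]
      partial_symmetric[OF assms, of _ j k]
    by (simp add: christoffel_lower[OF assms])
qed

end


section \<open>The electromagnetic tensor\<close>

lemma pd_has_derivative:
  assumes "(f has_derivative D) (at u)"
  shows "pd_t \<alpha> f u = D (axis \<alpha> 1, 0, 0)" "pd_x i f u = D (0, axis i 1, 0)"
    "pd_y i \<alpha> f u = D (0, 0, axis i (axis \<alpha> 1))"
  unfolding pd_t_def pd_x_def pd_y_def using frechet_derivative_at[OF assms] by metis+

lemma axis_axis_nth: "axis k (axis \<nu> a) $ i $ \<alpha> = (if k = i \<and> \<nu> = \<alpha> then a else 0)"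
  by (auto simp: axis_def)

lemma sum_sum_delta:
  fixes f :: "'k::finite \<Rightarrow> 'l::finite \<Rightarrow> real"
  shows "(\<Sum>k\<in>UNIV. \<Sum>\<nu>\<in>UNIV. f k \<nu> * (if k = i \<and> \<nu> = \<alpha> then a else 0)) = f i \<alpha> * a"
proof -
  have "(\<Sum>k\<in>UNIV. \<Sum>\<nu>\<in>UNIV. f k \<nu> * (if k = i \<and> \<nu> = \<alpha> then a else 0)) =
      (\<Sum>k\<in>UNIV. if k = i then (\<Sum>\<nu>\<in>UNIV. if \<nu> = \<alpha> then f i \<alpha> * a else 0) else 0)"
    by (intro sum.cong refl) (auto simp: if_distrib[of "\<lambda>a. _ * a"] cong: if_cong)
  then show ?thesis by simp
qed

lemma has_derivative_fst_at:
  assumes "(f has_derivative D) (at t)"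
  shows "((\<lambda>u. f (fst u)) has_derivative (\<lambda>v. D (fst v))) (at (t, x))"
  using diff_chain_at[of fst fst "(t, x)" f D] assms
  by (simp add: o_def has_derivative_fst)

section \<open>First and second derivatives of \<open>U\<close> and of its curl\<close>

locale local_EDML = T: local_metric T h + S: local_metric S g
  for T :: "(real^'p::finite) set" and h :: "real^'p \<Rightarrow> real^'p^'p"
    and S :: "(real^'n::finite) set" and g :: "real^'n \<Rightarrow> real^'n^'n" +
  fixes U :: "real^'p \<Rightarrow> real^'n \<Rightarrow> real^'p^'n"
  assumes smooth_U: "smooth_on (T \<times> S) (\<lambda>(t, x). U t x)"
begin

text \<open>The direction precedes the base point so that \<open>dU \<gamma> l v\<close> is a
  function of the point and can be differentiated again.\<close>

definition dU :: "'p \<Rightarrow> 'n \<Rightarrow> (real^'p) \<times> (real^'n) \<Rightarrow> (real^'p) \<times> (real^'n) \<Rightarrow> real" where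
  "dU \<gamma> l v p = frechet_derivative (\<lambda>(t, x). U t x $ l $ \<gamma>) (at p) v"

text \<open>This is the derivative of \<open>U_curl\<close> at \<open>(t, x)\<close> in direction
  \<open>v\<close>, as \<open>U_curl_has_derivative\<close> confirms.\<close>

definition dU_curl ::
  "'p \<Rightarrow> 'n \<Rightarrow> 'n \<Rightarrow> real^'p \<Rightarrow> real^'n \<Rightarrow> (real^'p) \<times> (real^'n) \<Rightarrow> real" where
  "dU_curl \<gamma> l j t x v =
     frechet_derivative (dU \<gamma> l (0, axis j 1)) (at (t, x)) v
     - frechet_derivative (dU \<gamma> j (0, axis l 1)) (at (t, x)) v"

lemma open_prod: "open (T \<times> S)"
  by (intro open_Times T.open_S S.open_S)

lemma smooth_U_nth: "smooth_on (T \<times> S) (\<lambda>(t, x). U t x $ l $ \<gamma>)"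
  using smooth_on_nth_nth[OF open_prod smooth_U] by (simp add: case_prod_unfold)

text \<open>Chain rule for the inclusion of the slice with fixed \<open>t\<close>. It ties the
  partial derivatives in \<open>x\<close> alone to the joint smoothness of \<open>U\<close> in
  \<open>(t, x)\<close>.\<close>

lemma partial_U:
  assumes "t \<in> T" "x \<in> S"
  shows "partial j (\<lambda>z. U t z $ l $ \<gamma>) x = dU \<gamma> l (0, axis j 1) (t, x)"
proof -
  have D: "((\<lambda>(t, x). U t x $ l $ \<gamma>) has_derivative
      frechet_derivative (\<lambda>(t, x). U t x $ l $ \<gamma>) (at (t, x))) (at (t, x))"
    using smooth_on_differentiable[OF smooth_U_nth] assms frechet_derivative_works by blast
  have "((\<lambda>z. (t, z)) has_derivative (\<lambda>v. (0, v))) (at x)"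
    by (auto intro!: derivative_eq_intros)
  from diff_chain_at[OF this D]
  have "((\<lambda>z. U t z $ l $ \<gamma>) has_derivative (\<lambda>v. dU \<gamma> l (0, v) (t, x))) (at x)"
    by (simp add: o_def dU_def)
  from frechet_derivative_at[OF this] show ?thesis
    unfolding partial_def by metis
qed

text \<open>On the open set \<open>T \<times> S\<close> the curl is a difference of two functions
  \<open>dU\<close>, which are differentiable; the result is then pulled back along the projection
  that forgets \<open>y\<close>.\<close>

lemma U_curl_has_derivative:
  assumes "t \<in> T" "x \<in> S"
  shows "((\<lambda>(t, x, y). U_curl U \<gamma> l j t x) has_derivative
    (\<lambda>(t', x', y'). dU_curl \<gamma> l j t x (t', x'))) (at (t, x, y))"
proof -
  have dU: "dU \<gamma> l v differentiable (at (t, x))" for \<gamma> l v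
    unfolding dU_def using assms
    by (intro smooth_on_differentiable[OF smooth_on_frechet_derivative[OF smooth_U_nth]]) auto
  have "((\<lambda>p. dU \<gamma> l (0, axis j 1) p - dU \<gamma> j (0, axis l 1) p) has_derivative
      dU_curl \<gamma> l j t x) (at (t, x))"
    unfolding dU_curl_def
    using dU by (intro has_derivative_diff) (simp_all flip: frechet_derivative_works)
  moreover have "dU \<gamma> l (0, axis j 1) p - dU \<gamma> j (0, axis l 1) p = U_curl U \<gamma> l j (fst p) (snd p)"
    if "p \<in> T \<times> S" for p
    using that by (auto simp: U_curl_def partial_U)
  ultimately have "((\<lambda>p. U_curl U \<gamma> l j (fst p) (snd p)) has_derivative dU_curl \<gamma> l j t x) (at (t, x))"
    using has_derivative_transform_within_open[where f = "\<lambda>p. dU \<gamma> l (0, axis j 1) p - dU \<gamma> j (0, axis l 1) p",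
        OF _ open_prod] assms by simp
  moreover have "((\<lambda>u. (fst u, fst (snd u))) has_derivative (\<lambda>u. (fst u, fst (snd u)))) (at (t, x, y))"
    by (auto intro!: derivative_eq_intros)
  ultimately show ?thesis
    using diff_chain_at[of "\<lambda>u. (fst u, fst (snd u))" "\<lambda>u. (fst u, fst (snd u))" "(t, x, y)"
        "\<lambda>p. U_curl U \<gamma> l j (fst p) (snd p)"]
    by (simp add: o_def case_prod_unfold)
qed

lemma U_curl_swap: "U_curl U \<gamma> j l t x = - U_curl U \<gamma> l j t x"
  by (simp add: U_curl_def)

lemma dU_curl_swap: "dU_curl \<gamma> j l t x v = - dU_curl \<gamma> l j t x v"
  by (simp add: dU_curl_def)

lemma dU_curl_zero:
  assumes "t \<in> T" "x \<in> S"
  shows "dU_curl \<gamma> l j t x (0, 0) = 0"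
  using linear_0[OF has_derivative_linear[OF U_curl_has_derivative[OF assms]]]
  by (simp add: zero_prod_def)

text \<open>The identity that the exterior derivative squares to zero: the six second derivatives
  cancel in pairs by symmetry.\<close>

lemma dU_curl_cyclic:
  assumes "t \<in> T" "x \<in> S"
  shows "dU_curl \<gamma> i j t x (0, axis k 1) + dU_curl \<gamma> j k t x (0, axis i 1)
    + dU_curl \<gamma> k i t x (0, axis j 1) = 0"
proof -
  have "frechet_derivative (dU \<gamma> l v) (at (t, x)) w = frechet_derivative (dU \<gamma> l w) (at (t, x)) v"
    for l v w
    unfolding dU_def
    using second_derivative_symmetric[OF open_prod _ smooth_U_nth] assms by blast
  from this[of i "(0, axis j 1)" "(0, axis k 1)"] this[of j "(0, axis k 1)" "(0, axis i 1)"]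
    this[of k "(0, axis i 1)" "(0, axis j 1)"] show ?thesis
    unfolding dU_curl_def by simp
qed

section \<open>The electromagnetic tensor and its covariant derivatives\<close>

text \<open>For each \<mu> the sum over \<open>m\<close> contracts \<open>g\<close> with its
  inverse; the sum over \<mu> then contracts the inverse of \<open>h\<close> with \<open>h\<close>.
  The array \<open>W\<close> is arbitrary because this serves both the deflection tensor and the
  torsion.\<close>

lemma inverse_contract2:
  assumes "t \<in> T" "x \<in> S"
  shows "(\<Sum>\<mu>\<in>UNIV. \<Sum>m\<in>UNIV. matrix_inv (h t) $ \<alpha> $ \<mu> * g x $ i $ m *
      (\<Sum>\<gamma>\<in>UNIV. \<Sum>l\<in>UNIV. h t $ \<mu> $ \<gamma> * matrix_inv (g x) $ m $ l * W \<gamma> l)) = W \<alpha> i"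
proof -
  have "(\<Sum>m\<in>UNIV. matrix_inv (h t) $ \<alpha> $ \<mu> * g x $ i $ m *
      (\<Sum>\<gamma>\<in>UNIV. \<Sum>l\<in>UNIV. h t $ \<mu> $ \<gamma> * matrix_inv (g x) $ m $ l * W \<gamma> l)) =
    matrix_inv (h t) $ \<alpha> $ \<mu> * (\<Sum>\<gamma>\<in>UNIV. h t $ \<mu> $ \<gamma> * W \<gamma> i)" for \<mu>
  proof -
    have "(\<Sum>m\<in>UNIV. matrix_inv (h t) $ \<alpha> $ \<mu> * g x $ i $ m *
        (\<Sum>\<gamma>\<in>UNIV. \<Sum>l\<in>UNIV. h t $ \<mu> $ \<gamma> * matrix_inv (g x) $ m $ l * W \<gamma> l)) =
      matrix_inv (h t) $ \<alpha> $ \<mu> * (\<Sum>m\<in>UNIV. \<Sum>\<gamma>\<in>UNIV. h t $ \<mu> $ \<gamma> *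
        (g x $ i $ m * (\<Sum>l\<in>UNIV. matrix_inv (g x) $ m $ l * W \<gamma> l)))"
      by (simp add: sum_distrib_left mult.assoc mult.left_commute)
    also have "(\<Sum>m\<in>UNIV. \<Sum>\<gamma>\<in>UNIV. h t $ \<mu> $ \<gamma> *
        (g x $ i $ m * (\<Sum>l\<in>UNIV. matrix_inv (g x) $ m $ l * W \<gamma> l))) =
      (\<Sum>\<gamma>\<in>UNIV. h t $ \<mu> $ \<gamma> * (\<Sum>m\<in>UNIV.
        g x $ i $ m * (\<Sum>l\<in>UNIV. matrix_inv (g x) $ m $ l * W \<gamma> l)))"
      by (subst sum.swap) (simp add: sum_distrib_left)
    finally show ?thesis by (simp add: S.inverse_contract(1)[OF assms(2)])
  qed
  then show ?thesis by (simp add: T.inverse_contract(2)[OF assms(1)])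
qed

text \<open>The adapted derivative of the coordinate function \<open>y $ i $ \<alpha>\<close> is
  minus the component of \<open>N\<close>. Its part linear in \<open>y\<close> cancels against the
  connection term once the lower Christoffel indices are exchanged.\<close>

lemma y_cov_x_eq:
  assumes "x \<in> S"
  shows "y_cov_x h g U i \<alpha> j (t, x, y) =
    (\<Sum>\<gamma>\<in>UNIV. \<Sum>l\<in>UNIV. h t $ \<alpha> $ \<gamma> * matrix_inv (g x) $ i $ l * (- 1/4 * U_curl U \<gamma> l j t x))"
proof -
  have D: "((\<lambda>(t, x, y). y $ i $ \<alpha>) has_derivative (\<lambda>(t, x, y). y $ i $ \<alpha>)) (at (t, x, y))"
    unfolding case_prod_beta
    by (intro bounded_linear_imp_has_derivative bounded_linear_compose[OF bounded_linear_vec_nth]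
        bounded_linear_compose[OF bounded_linear_snd] bounded_linear_snd)
  show ?thesis
    unfolding y_cov_x_def delta_x_def split_conv pd_has_derivative[OF D] axis_axis_nth sum_sum_delta
    by (simp add: N_conn_def S.christoffel_symmetric[OF assms, of i j]
        sum_negf mult.commute mult.left_commute)
qed

text \<open>The deflection tensor is contracted to a multiple of the curl and so is already
  antisymmetric; half of its alternation gives it back.\<close>

lemma em_tensor_eq:
  assumes "t \<in> T" "x \<in> S"
  shows "em_tensor h g U \<alpha> i j (t, x, y) = - 1/4 * U_curl U \<alpha> i j t x"
proof -
  have "deflection h g U \<alpha> i j (t, x, y) = - 1/4 * U_curl U \<alpha> i j t x" for i j
    unfolding deflection_def split_conv y_cov_x_eq[OF assms(2)] inverse_contract2[OF assms] ..
  then show ?thesis by (simp add: em_tensor_def U_curl_swap[of \<alpha> j i])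
qed

lemma em_tensor_has_derivative:
  assumes "t \<in> T" "x \<in> S"
  shows "(em_tensor h g U \<alpha> i j has_derivative
    (\<lambda>(t', x', y'). - 1/4 * dU_curl \<alpha> i j t x (t', x'))) (at (t, x, y))"
proof (rule has_derivative_transform_within_open)
  show "((\<lambda>u. - 1/4 * (case u of (t, x, y) \<Rightarrow> U_curl U \<alpha> i j t x)) has_derivative
      (\<lambda>(t', x', y'). - 1/4 * dU_curl \<alpha> i j t x (t', x'))) (at (t, x, y))"
    using has_derivative_mult_right[OF U_curl_has_derivative[OF assms], of "- 1/4"]
    by (simp add: case_prod_unfold)
  show "open (T \<times> S \<times> UNIV)"
    by (intro open_Times T.open_S S.open_S open_UNIV)
qed (use assms em_tensor_eq in auto)

lemma pd_em_tensor:
  assumes "t \<in> T" "x \<in> S"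
  shows "pd_t \<beta> (em_tensor h g U \<alpha> i j) (t, x, y) = - 1/4 * dU_curl \<alpha> i j t x (axis \<beta> 1, 0)"
    "pd_x k (em_tensor h g U \<alpha> i j) (t, x, y) = - 1/4 * dU_curl \<alpha> i j t x (0, axis k 1)"
    "pd_y k \<gamma> (em_tensor h g U \<alpha> i j) (t, x, y) = 0"
  using pd_has_derivative[OF em_tensor_has_derivative[OF assms]] dU_curl_zero[OF assms]
  by simp_all

lemma em_tensor_cov_y:
  "t \<in> T \<Longrightarrow> x \<in> S \<Longrightarrow> cov_y (em_tensor h g U) \<alpha> i j \<gamma> k (t, x, y) = 0"
  by (simp add: cov_y_def pd_em_tensor)

lemma em_tensor_cov_x_cyclic:
  assumes "t \<in> T" "x \<in> S"
  shows "cyclic_sum (\<lambda>i j k. cov_x h g U (em_tensor h g U) \<alpha> i j k (t, x, y)) i j k = 0"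
proof -
  let ?E = "\<lambda>i j. - 1/4 * U_curl U \<alpha> i j t x"
  let ?A = "\<lambda>i j k. \<Sum>m\<in>UNIV. ?E i m * christoffel g m j k x"
  have A: "?A i j k = ?A i k j" for i j k
    by (simp add: S.christoffel_symmetric[OF assms(2), of _ j k])
  \<comment> \<open>Antisymmetry of the curl brings the correction for the first index to the same
    form \<open>?A\<close> as that for the second.\<close>
  have "(\<Sum>m\<in>UNIV. ?E m j * christoffel g m i k x) = - ?A j i k" for i j k
    by (simp add: U_curl_swap[of \<alpha> _ j] flip: sum_negf)
  then have "cov_x h g U (em_tensor h g U) \<alpha> i j k (t, x, y) =
      - 1/4 * dU_curl \<alpha> i j t x (0, axis k 1) + ?A j i k - ?A i j k" for i j k
    by (simp add: cov_x_def delta_x_def pd_em_tensor[OF assms] em_tensor_eq[OF assms])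
  \<comment> \<open>The cyclic sum contains each \<open>?A\<close> once with either sign, up to
    exchanging its last two indices, and the remaining derivatives cancel by
    \<open>dU_curl_cyclic\<close>.\<close>
  then show ?thesis
    unfolding cyclic_sum_def
    using dU_curl_cyclic[OF assms, of \<alpha> i j k] A[of i j k] A[of j k i] A[of k i j] by simp
qed

lemma em_tensor_cov_t:
  assumes "t \<in> T" "x \<in> S"
  shows "cov_t h (em_tensor h g U) \<alpha> i j \<beta> (t, x, y) =
    - 1/4 * ((\<Sum>\<gamma>\<in>UNIV. christoffel h \<alpha> \<gamma> \<beta> t * U_curl U \<gamma> i j t x) + dU_curl \<alpha> i j t x (axis \<beta> 1, 0))"
  by (simp add: cov_t_def delta_t_def pd_em_tensor[OF assms] em_tensor_eq[OF assms]
      sum_distrib_left algebra_simps)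

section \<open>Derivatives of the nonlinear connection and the torsion component\<close>

lemma M_conn_has_derivative:
  assumes "t \<in> T"
  shows "(M_conn h i \<alpha> \<beta> has_derivative (\<lambda>(t', x', y').
    - (\<Sum>\<gamma>\<in>UNIV. christoffel h \<gamma> \<alpha> \<beta> t * y' $ i $ \<gamma>
        + frechet_derivative (christoffel h \<gamma> \<alpha> \<beta>) (at t) t' * y $ i $ \<gamma>))) (at (t, x, y))"
proof -
  have D: "((\<lambda>u. christoffel h \<gamma> \<alpha> \<beta> (fst u)) has_derivative
      (\<lambda>v. frechet_derivative (christoffel h \<gamma> \<alpha> \<beta>) (at t) (fst v))) (at (t, x, y))" for \<gamma>
    using T.christoffel_differentiable[OF assms] frechet_derivative_works
    by (intro has_derivative_fst_at) blast
  show ?thesis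
    unfolding M_conn_def case_prod_unfold
    by (rule derivative_eq_intros D bounded_linear.has_derivative[OF bounded_linear_vec_nth] refl)+ simp
qed

text \<open>\<open>M_conn\<close> is constant in \<open>x\<close> and linear in \<open>y\<close>, so
  only the vertical part of the adapted derivative contributes; its minus sign cancels the one in
  \<open>M_conn\<close>.\<close>

lemma delta_x_M_conn:
  assumes "t \<in> T"
  shows "delta_x h g U j (M_conn h m \<mu> \<beta>) (t, x, y) =
    (\<Sum>\<nu>\<in>UNIV. N_conn h g U m \<nu> j (t, x, y) * christoffel h \<nu> \<mu> \<beta> t)"
proof -
  note pd = pd_has_derivative[OF M_conn_has_derivative[OF assms]]
  have 0: "frechet_derivative (christoffel h \<gamma> \<mu> \<beta>) (at t) 0 = 0" for \<gamma>
    using T.christoffel_differentiable[OF assms] linear_frechet_derivative linear_0 by blast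
  have "pd_y k \<nu> (M_conn h m \<mu> \<beta>) (t, x, y) = (if k = m then - christoffel h \<nu> \<mu> \<beta> t else 0)" for k \<nu>
    unfolding pd by (simp add: 0 axis_axis_nth if_distrib[of "\<lambda>a. _ * a"] cong: if_cong)
  moreover have "pd_x j (M_conn h m \<mu> \<beta>) (t, x, y) = 0"
    unfolding pd by (simp add: 0)
  moreover have "(\<Sum>k\<in>UNIV. \<Sum>\<nu>\<in>UNIV. A k \<nu> * (if k = m then - B \<nu> else 0)) =
      - (\<Sum>\<nu>\<in>UNIV. A m \<nu> * B \<nu>)" for A :: "'n \<Rightarrow> 'p \<Rightarrow> real" and B
  proof -
    have "(\<Sum>k\<in>UNIV. \<Sum>\<nu>\<in>UNIV. A k \<nu> * (if k = m then - B \<nu> else 0)) =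
        (\<Sum>k\<in>UNIV. if k = m then - (\<Sum>\<nu>\<in>UNIV. A m \<nu> * B \<nu>) else 0)"
      by (intro sum.cong refl) (auto simp: sum_negf)
    then show ?thesis by simp
  qed
  ultimately show ?thesis by (simp add: delta_x_def)
qed

lemma N_conn_has_derivative:
  assumes "t \<in> T" "x \<in> S"
  shows "(N_conn h g U i \<alpha> j has_derivative (\<lambda>(t', x', y').
    (\<Sum>k\<in>UNIV. christoffel g i j k x * y' $ k $ \<alpha>
        + frechet_derivative (christoffel g i j k) (at x) x' * y $ k $ \<alpha>) +
    (\<Sum>\<gamma>\<in>UNIV. \<Sum>l\<in>UNIV.
      h t $ \<alpha> $ \<gamma> * matrix_inv (g x) $ i $ l / 4 * dU_curl \<gamma> l j t x (t', x')
      + (h t $ \<alpha> $ \<gamma> * frechet_derivative (\<lambda>x. matrix_inv (g x) $ i $ l) (at x) x'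
         + frechet_derivative (\<lambda>t. h t $ \<alpha> $ \<gamma>) (at t) t' * matrix_inv (g x) $ i $ l) / 4
        * U_curl U \<gamma> l j t x))) (at (t, x, y))"
proof -
  have snd_at: "((\<lambda>u. f (fst (snd u))) has_derivative (\<lambda>v. frechet_derivative f (at x) (fst (snd v))))
      (at (t, x, y))" if "f differentiable (at x)" for f :: "real^'n \<Rightarrow> real"
  proof -
    have "(f has_derivative frechet_derivative f (at x)) (at (fst (snd (t, x, y))))"
      using that by (simp flip: frechet_derivative_works)
    moreover have "((\<lambda>u. fst (snd u)) has_derivative (\<lambda>u. fst (snd u))) (at (t, x, y))"
      by (auto intro!: derivative_eq_intros)
    ultimately show ?thesis
      using diff_chain_at[of "\<lambda>u. fst (snd u)" "\<lambda>u. fst (snd u)" "(t, x, y)" f] by (simp add: o_def)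
  qed
  have h: "((\<lambda>u. h (fst u) $ \<alpha> $ \<gamma>) has_derivative
      (\<lambda>v. frechet_derivative (\<lambda>t. h t $ \<alpha> $ \<gamma>) (at t) (fst v))) (at (t, x, y))" for \<gamma>
    using T.differentiable[OF assms(1)] frechet_derivative_works
    by (intro has_derivative_fst_at[where f = "\<lambda>t. h t $ \<alpha> $ \<gamma>"]) blast
  note g_inv = snd_at[OF S.matrix_inv_differentiable[OF assms(2)]]
  note V = U_curl_has_derivative[OF assms, unfolded case_prod_unfold]
  note \<Gamma> = snd_at[OF S.christoffel_differentiable[OF assms(2)]]
  have y: "((\<lambda>u. snd (snd u) $ k $ \<alpha>) has_derivative (\<lambda>v. snd (snd v) $ k $ \<alpha>)) (at (t, x, y))" for k
    by (intro bounded_linear_imp_has_derivative bounded_linear_compose[OF bounded_linear_vec_nth]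
        bounded_linear_compose[OF bounded_linear_snd] bounded_linear_snd)
  note has_derivative_mult[OF bounded_linear.has_derivative[OF bounded_linear_divide
        has_derivative_mult[OF h g_inv]] V]
  note UV = has_derivative_sum[OF has_derivative_sum[OF this]]
  note \<Gamma>y = has_derivative_sum[OF has_derivative_mult[OF \<Gamma> y]]
  show ?thesis
    unfolding N_conn_def case_prod_unfold
    by (rule has_derivative_eq_rhs[OF has_derivative_add[OF \<Gamma>y UV]]) simp
qed

text \<open>The plain \<beta>-derivative acts on \<open>h\<close> and on the curl. The vertical part
  sees the Christoffel term of \<open>N_conn\<close>, and the two minus signs from the adapted frame
  and from \<open>M_conn\<close> cancel.\<close>

lemma delta_t_N_conn:
  assumes "t \<in> T" "x \<in> S"
  shows "delta_t h \<beta> (N_conn h g U m \<mu> j) (t, x, y) =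
    (\<Sum>\<gamma>\<in>UNIV. \<Sum>l\<in>UNIV. matrix_inv (g x) $ m $ l / 4 *
      (h t $ \<mu> $ \<gamma> * dU_curl \<gamma> l j t x (axis \<beta> 1, 0)
       + partial \<beta> (\<lambda>t. h t $ \<mu> $ \<gamma>) t * U_curl U \<gamma> l j t x))
    + (\<Sum>k\<in>UNIV. (\<Sum>\<gamma>\<in>UNIV. christoffel h \<gamma> \<mu> \<beta> t * y $ k $ \<gamma>) * christoffel g m j k x)"
proof -
  note pd = pd_has_derivative[OF N_conn_has_derivative[OF assms]]
  have 0: "frechet_derivative (christoffel g m j k) (at x) 0 = 0"
    "frechet_derivative (\<lambda>x. matrix_inv (g x) $ m $ l) (at x) 0 = 0"
    "frechet_derivative (\<lambda>t. h t $ \<mu> $ \<gamma>) (at t) 0 = 0" for k l \<gamma>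
    using S.christoffel_differentiable[OF assms(2)] T.differentiable[OF assms(1)]
      S.matrix_inv_differentiable[OF assms(2)]
      linear_frechet_derivative linear_0 by blast+
  have "pd_y k \<nu> (N_conn h g U m \<mu> j) (t, x, y) = (if \<nu> = \<mu> then christoffel g m j k x else 0)" for k \<nu>
    unfolding pd by (simp add: 0 dU_curl_zero[OF assms] axis_axis_nth
        if_distrib[of "\<lambda>a. _ * a"] cong: if_cong)
  moreover have "pd_t \<beta> (N_conn h g U m \<mu> j) (t, x, y) =
    (\<Sum>\<gamma>\<in>UNIV. \<Sum>l\<in>UNIV. matrix_inv (g x) $ m $ l / 4 *
      (h t $ \<mu> $ \<gamma> * dU_curl \<gamma> l j t x (axis \<beta> 1, 0)
       + partial \<beta> (\<lambda>t. h t $ \<mu> $ \<gamma>) t * U_curl U \<gamma> l j t x))"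
    unfolding pd by (simp add: 0 partial_def algebra_simps)
  ultimately show ?thesis
    by (simp add: delta_t_def M_conn_def if_distrib[of "\<lambda>a. _ * a"] sum_negf cong: if_cong)
qed

text \<open>The terms linear in \<open>y\<close> agree in both halves of the torsion and cancel.
  Metric compatibility splits the derivative of \<open>h\<close> in two: one part cancels against
  \<open>N\<close> contracted with the Christoffel symbols of \<open>h\<close>, the other completes
  the covariant derivative of the curl.\<close>

lemma torsion_R_eq:
  assumes "t \<in> T" "x \<in> S"
  shows "torsion_R h g U m \<mu> \<beta> j (t, x, y) =
    (\<Sum>\<eta>\<in>UNIV. \<Sum>l\<in>UNIV. h t $ \<mu> $ \<eta> * matrix_inv (g x) $ m $ l *
      (- 1/4 * ((\<Sum>\<gamma>\<in>UNIV. christoffel h \<eta> \<gamma> \<beta> t * U_curl U \<gamma> l j t x)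
        + dU_curl \<eta> l j t x (axis \<beta> 1, 0))))"
proof -
  let ?H = "\<lambda>\<nu> \<mu>. christoffel h \<nu> \<mu> \<beta> t"
  let ?V = "\<lambda>\<gamma> l. U_curl U \<gamma> l j t x"
  let ?d = "\<lambda>\<gamma> l. dU_curl \<gamma> l j t x (axis \<beta> 1, 0)"
  let ?h = "\<lambda>\<mu> \<nu>. h t $ \<mu> $ \<nu>"
  let ?a = "\<lambda>l. matrix_inv (g x) $ m $ l / 4"
  \<comment> \<open>By \<open>T.partial_metric\<close>, \<open>?P \<gamma>\<close> is the
    \<beta>-derivative of \<open>h t $ \<mu> $ \<gamma>\<close>.\<close>
  let ?P = "\<lambda>\<gamma>. (\<Sum>\<nu>\<in>UNIV. ?H \<nu> \<mu> * ?h \<nu> \<gamma>) + (\<Sum>\<nu>\<in>UNIV. ?H \<nu> \<gamma> * ?h \<mu> \<nu>)"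
  have linear_y: "(\<Sum>\<nu>\<in>UNIV. (\<Sum>k\<in>UNIV. christoffel g m j k x * y $ k $ \<nu>) * ?H \<nu> \<mu>) =
      (\<Sum>k\<in>UNIV. (\<Sum>\<gamma>\<in>UNIV. ?H \<gamma> \<mu> * y $ k $ \<gamma>) * christoffel g m j k x)"
    by (simp add: sum_distrib_right sum_distrib_left mult_ac) (rule sum.swap)
  have swap1: "(\<Sum>\<nu>\<in>UNIV. (\<Sum>\<gamma>\<in>UNIV. \<Sum>l\<in>UNIV. ?h \<nu> \<gamma> * ?a l * ?V \<gamma> l) * ?H \<nu> \<mu>) =
      (\<Sum>\<gamma>\<in>UNIV. \<Sum>l\<in>UNIV. ?a l * ((\<Sum>\<nu>\<in>UNIV. ?H \<nu> \<mu> * ?h \<nu> \<gamma>) * ?V \<gamma> l))"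
  proof -
    have "(\<Sum>\<nu>\<in>UNIV. (\<Sum>\<gamma>\<in>UNIV. \<Sum>l\<in>UNIV. ?h \<nu> \<gamma> * ?a l * ?V \<gamma> l) * ?H \<nu> \<mu>) =
        (\<Sum>\<nu>\<in>UNIV. \<Sum>\<gamma>\<in>UNIV. \<Sum>l\<in>UNIV. ?a l * (?H \<nu> \<mu> * ?h \<nu> \<gamma> * ?V \<gamma> l))"
      by (simp add: sum_distrib_left sum_distrib_right mult_ac)
    also have "\<dots> = (\<Sum>\<gamma>\<in>UNIV. \<Sum>l\<in>UNIV. \<Sum>\<nu>\<in>UNIV. ?a l * (?H \<nu> \<mu> * ?h \<nu> \<gamma> * ?V \<gamma> l))"
      by (subst sum.swap, intro sum.cong refl) (rule sum.swap)
    finally show ?thesis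
      by (simp only: sum_distrib_left sum_distrib_right)
  qed
  \<comment> \<open>Exchanging the names of the summation indices moves the Christoffel symbol from
    the metric onto the curl.\<close>
  have swap2: "(\<Sum>\<gamma>\<in>UNIV. \<Sum>l\<in>UNIV. ?a l * ((\<Sum>\<nu>\<in>UNIV. ?H \<nu> \<gamma> * ?h \<mu> \<nu>) * ?V \<gamma> l)) =
      (\<Sum>\<eta>\<in>UNIV. \<Sum>l\<in>UNIV. ?a l * (?h \<mu> \<eta> * (\<Sum>\<gamma>\<in>UNIV. ?H \<eta> \<gamma> * ?V \<gamma> l)))"
  proof -
    have "(\<Sum>\<gamma>\<in>UNIV. \<Sum>l\<in>UNIV. ?a l * ((\<Sum>\<nu>\<in>UNIV. ?H \<nu> \<gamma> * ?h \<mu> \<nu>) * ?V \<gamma> l)) =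
        (\<Sum>\<gamma>\<in>UNIV. \<Sum>l\<in>UNIV. \<Sum>\<nu>\<in>UNIV. ?a l * (?h \<mu> \<nu> * (?H \<nu> \<gamma> * ?V \<gamma> l)))"
      by (simp add: sum_distrib_right sum_distrib_left mult_ac)
    also have "\<dots> = (\<Sum>\<gamma>\<in>UNIV. \<Sum>\<nu>\<in>UNIV. \<Sum>l\<in>UNIV. ?a l * (?h \<mu> \<nu> * (?H \<nu> \<gamma> * ?V \<gamma> l)))"
      by (intro sum.cong refl) (rule sum.swap)
    also have "\<dots> = (\<Sum>\<nu>\<in>UNIV. \<Sum>l\<in>UNIV. \<Sum>\<gamma>\<in>UNIV. ?a l * (?h \<mu> \<nu> * (?H \<nu> \<gamma> * ?V \<gamma> l)))"
      by (subst sum.swap, intro sum.cong refl) (rule sum.swap)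
    finally show ?thesis
      by (simp only: sum_distrib_left)
  qed
  have N: "N_conn h g U m \<nu> j (t, x, y) = (\<Sum>k\<in>UNIV. christoffel g m j k x * y $ k $ \<nu>)
      + (\<Sum>\<gamma>\<in>UNIV. \<Sum>l\<in>UNIV. ?h \<nu> \<gamma> * ?a l * ?V \<gamma> l)" for \<nu>
    by (simp add: N_conn_def)
  have "torsion_R h g U m \<mu> \<beta> j (t, x, y) =
      (\<Sum>\<nu>\<in>UNIV. (\<Sum>\<gamma>\<in>UNIV. \<Sum>l\<in>UNIV. ?h \<nu> \<gamma> * ?a l * ?V \<gamma> l) * ?H \<nu> \<mu>)
      - (\<Sum>\<gamma>\<in>UNIV. \<Sum>l\<in>UNIV. ?a l * (?h \<mu> \<gamma> * ?d \<gamma> l + ?P \<gamma> * ?V \<gamma> l))"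
    unfolding torsion_R_def delta_x_M_conn[OF assms(1)] delta_t_N_conn[OF assms] N
      T.partial_metric[OF assms(1)] distrib_right[of _ _ "?H _ _"] sum.distrib[of "\<lambda>\<nu>. _ \<nu> * ?H \<nu> \<mu>"] linear_y
    by simp
  \<comment> \<open>By \<open>swap1\<close> the first sum is exactly the contribution of the first
    half of \<open>?P\<close>; \<open>swap2\<close> rewrites that of the second half.\<close>
  also have "\<dots> = - (\<Sum>\<eta>\<in>UNIV. \<Sum>l\<in>UNIV. ?a l * (?h \<mu> \<eta> * (\<Sum>\<gamma>\<in>UNIV. ?H \<eta> \<gamma> * ?V \<gamma> l)))
      - (\<Sum>\<gamma>\<in>UNIV. \<Sum>l\<in>UNIV. ?a l * (?h \<mu> \<gamma> * ?d \<gamma> l))"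
    unfolding swap1 distrib_left distrib_right sum.distrib swap2 by simp
  also have "\<dots> = (\<Sum>\<eta>\<in>UNIV. \<Sum>l\<in>UNIV. ?h \<mu> \<eta> * matrix_inv (g x) $ m $ l *
      (- 1/4 * ((\<Sum>\<gamma>\<in>UNIV. ?H \<eta> \<gamma> * ?V \<gamma> l) + ?d \<eta> l)))"
    by (simp add: distrib_left right_diff_distrib sum.distrib sum_negf mult_ac sum_subtractf)
  finally show ?thesis .
qed

text \<open>Contraction strips the metrics from the torsion and leaves -1/4 times the covariant
  \<beta>-derivative of the curl. This is antisymmetric in \<open>i\<close> and \<open>j\<close>, so
  half of its alternation is the left-hand side.\<close>

lemma em_tensor_cov_t_torsion:
  assumes "t \<in> T" "x \<in> S"
  shows "cov_t h (em_tensor h g U) \<alpha> i j \<beta> (t, x, y) =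
    1/2 * alternate_sum (\<lambda>i j. \<Sum>\<mu>\<in>UNIV. \<Sum>m\<in>UNIV. matrix_inv (h t) $ \<alpha> $ \<mu> * g x $ i $ m *
      torsion_R h g U m \<mu> \<beta> j (t, x, y)) i j"
  unfolding alternate_sum_def torsion_R_eq[OF assms] inverse_contract2[OF assms]
    em_tensor_cov_t[OF assms]
  by (simp add: U_curl_swap[of _ j i] dU_curl_swap[of _ j i] sum_negf field_simps)

end

section \<open>From the manifolds to one pair of charts\<close>

lemma semi_riemannian_metric_local:
  assumes "smooth_structure \<A>" "semi_riemannian_metric \<A> g" "c \<in> \<A>"
  shows "local_metric (chart_range c) (g c)"
proof
  show "open (chart_range c)" "smooth_on (chart_range c) (g c)"
    using assms unfolding smooth_structure_def is_chart_def semi_riemannian_metric_def by blast+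
  fix x assume "x \<in> chart_range c"
  then have "invertible (g c x)" "transpose (g c x) = g c x"
    using assms unfolding semi_riemannian_metric_def by blast+
  then show "invertible (g c x)" "g c x $ i $ j = g c x $ j $ i" for i j
    by (simp, metis transpose_def vec_lambda_beta)
qed

lemma EDML_space_local:
  assumes "EDML_space \<A> \<B> h g U F L" "c \<in> \<A>" "d \<in> \<B>"
  shows "local_EDML (chart_range c) (h c) (chart_range d) (g d) (U c d)"
proof (intro local_EDML.intro local_EDML_axioms.intro)
  show "local_metric (chart_range c) (h c)" "local_metric (chart_range d) (g d)"
    using assms unfolding EDML_space_def by (blast intro: semi_riemannian_metric_local)+
  show "smooth_on (chart_range c \<times> chart_range d) (\<lambda>(t, x). U c d t x)"
    using assms unfolding EDML_space_def basic_d_tensor_def by blast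
qed

theorem theorem3p2:
  fixes \<A> :: "('a::{t2_space, second_countable_topology}, 'p::finite) chart set"
    and \<B> :: "('b::{t2_space, second_countable_topology}, 'n::finite) chart set"
    and h :: "('a, 'p) chart \<Rightarrow> real^'p \<Rightarrow> real^'p^'p"
    and g :: "('b, 'n) chart \<Rightarrow> real^'n \<Rightarrow> real^'n^'n"
    and U :: "('a, 'p) chart \<Rightarrow> ('b, 'n) chart \<Rightarrow> real^'p \<Rightarrow> real^'n \<Rightarrow> real^'p^'n"
    and F :: "'a \<Rightarrow> 'b \<Rightarrow> real"
    and L :: "'a \<times> ('a \<Rightarrow> 'b) set \<Rightarrow> real"
    and c :: "('a, 'p) chart" and d :: "('b, 'n) chart"
    and t :: "real^'p" and x :: "real^'n" and y :: "real^'p^'n"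
    and \<alpha> \<beta> \<gamma> :: 'p and i j k :: 'n
  assumes "EDML_space \<A> \<B> h g U F L"
    and "c \<in> \<A>" and "d \<in> \<B>"
    and "t \<in> chart_range c" and "x \<in> chart_range d"
  shows "cov_t (h c) (em_tensor (h c) (g d) (U c d)) \<alpha> i j \<beta> (t, x, y) =
           1/2 * alternate_sum (\<lambda>i j. \<Sum>\<mu>\<in>UNIV. \<Sum>m\<in>UNIV.
             matrix_inv (h c t) $ \<alpha> $ \<mu> * g d x $ i $ m *
             torsion_R (h c) (g d) (U c d) m \<mu> \<beta> j (t, x, y)) i j
         \<and> cyclic_sum (\<lambda>i j k.
             cov_x (h c) (g d) (U c d) (em_tensor (h c) (g d) (U c d)) \<alpha> i j k (t, x, y)) i j k = 0
         \<and> cyclic_sum (\<lambda>i j k.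
             cov_y (em_tensor (h c) (g d) (U c d)) \<alpha> i j \<gamma> k (t, x, y)) i j k = 0"
proof -
  interpret local_EDML "chart_range c" "h c" "chart_range d" "g d" "U c d"
    using assms(1-3) by (rule EDML_space_local)
  \<comment> \<open>In the third equation each of the three cyclic terms vanishes
    separately.\<close>
  show ?thesis
    using em_tensor_cov_t_torsion[OF assms(4,5)] em_tensor_cov_x_cyclic[OF assms(4,5)]
      em_tensor_cov_y[OF assms(4,5)]
    by (simp add: cyclic_sum_def)
qed

end
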